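(* For any positive integers $q,n,k$ with $q\leq n$ and $k\leq 2^n$, $$m_q(n,k)=h_q(n,k).$$ That is, the minimum of $m_q(M)$ over all $k\times n$ binary matrices $M$ with pairwise distinct rows is attained by the matrix $H_{n,k}$ whose rows are the $n$-bit binary representations of $0,1,\dots,k-1$.
   Context: For integers $a\le b$, $[a,b]=\{a,a+1,\dots,b\}$. $\binom{[1,n]}{q}$ denotes the set of $q$-element subsets of $[1,n]$. $\mathcal{M}_{n,k}$ is the set of all $k\times n$ binary ($0/1$) matrices whose $k$ rows are pairwise distinct. For a binary matrix $A$, $\mathrm{dif}(A)$ is the number of distinct rows of $A$ (the cardinality of the set of its rows). For a set $Q$ of column indices, $M(Q)$ is the submatrix of $M$ formed by the columns with indices in $Q$. For $M\in\mathcal{M}_{n,k}$ put $$m_q(M)=\sum_{Q\in\binom{[1,n]}{q}}\mathrm{dif}(M(Q)),\qquad m_q(n,k)=\min_{M\in\mathcal{M}_{n,k}}m_q(M).$$ $H_{n,k}$ ($1\le k\le 2^n$) is the $k\times n$ binary matrix whose rows are the binary representations of the integers $0,1,\dots,k-1$, padded with leading zeros to length $n$ (the order of the rows is irrelevant for $m_q$). Finally $h_q(n,k)=m_q(H_{n,k})$. *)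

theory Defs
  imports "Jordan_Normal_Form.Matrix" "Jordan_Normal_Form.DL_Submatrix" "HOL-Library.FuncSet"
begin

definition dif :: "'a mat \<Rightarrow> nat" where
  "dif A = card (set (rows A))"

definition distinct_row_mats :: "nat \<Rightarrow> nat \<Rightarrow> nat mat set" where
  "distinct_row_mats n k =
     {M \<in> carrier_mat k n. elements_mat M \<subseteq> {0, 1} \<and> distinct (rows M)}"

(* Columns are indexed by {0..<n}, the library's counterpart of [1,n]. *)
definition col_sets :: "nat \<Rightarrow> nat \<Rightarrow> nat set set" where
  "col_sets n q = {Q. Q \<subseteq> {0..<n} \<and> card Q = q}"

definition msum :: "nat \<Rightarrow> 'a mat \<Rightarrow> nat" where
  "msum q M = (\<Sum>Q\<in>col_sets (dim_col M) q. dif (submatrix M UNIV Q))"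

(* The set of matrices is finite, and it is nonempty exactly when k <= 2^n;
   Min is unspecified for larger k. *)
definition msum_min :: "nat \<Rightarrow> nat \<Rightarrow> nat \<Rightarrow> nat" where
  "msum_min q n k = Min (msum q ` distinct_row_mats n k)"

(* Row i is the n-bit binary representation of i, most significant bit in column 0. *)
definition H_mat :: "nat \<Rightarrow> nat \<Rightarrow> nat mat" where
  "H_mat n k = mat k n (\<lambda>(i, j). of_bool (bit i (n - 1 - j)))"

definition hsum :: "nat \<Rightarrow> nat \<Rightarrow> nat \<Rightarrow> nat" where
  "hsum q n k = msum q (H_mat n k)"

lemma finite_distinct_row_mats: "finite (distinct_row_mats n k)"
proof (rule finite_subset)
  let ?F = "({0..<k} \<times> {0..<n}) \<rightarrow>\<^sub>E {0, 1 :: nat}"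
  show "distinct_row_mats n k \<subseteq> mat k n ` ?F"
  proof
    fix M assume M: "M \<in> distinct_row_mats n k"
    let ?f = "restrict (\<lambda>p. M $$ p) ({0..<k} \<times> {0..<n})"
    have "M $$ (i, j) \<in> {0, 1}" if "i < k" "j < n" for i j
      using M that unfolding distinct_row_mats_def elements_mat_def by fastforce
    then have "?f \<in> ?F"
      by (auto simp: PiE_iff)
    moreover have "M = mat k n ?f"
      using M by (intro eq_matI) (auto simp: distinct_row_mats_def)
    ultimately show "M \<in> mat k n ` ?F" by blast
  qed
  show "finite (mat k n ` ?F)" by (intro finite_imageI finite_PiE) auto
qed

lemma H_mat_in_distinct_row_mats:
  assumes "k \<le> 2 ^ n"
  shows "H_mat n k \<in> distinct_row_mats n k"
proof -
  have "i = i'" if i: "i < k" "i' < k" and eq: "row (H_mat n k) i = row (H_mat n k) i'" for i i'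
  proof -
    have "bit i b = bit i' b" if "b < n" for b
    proof -
      have "row (H_mat n k) i $ (n - 1 - b) = row (H_mat n k) i' $ (n - 1 - b)"
        using eq by simp
      with i that have "(of_bool (bit i b) :: nat) = of_bool (bit i' b)"
        by (simp add: H_mat_def)
      then show ?thesis by (simp only: of_bool_eq_iff)
    qed
    then have "take_bit n i = take_bit n i'"
      by (intro bit_eqI) (auto simp: bit_take_bit_iff)
    moreover have "i < 2 ^ n" "i' < 2 ^ n" using i assms by auto
    ultimately show ?thesis by (simp add: take_bit_nat_eq_self)
  qed
  then have "distinct (rows (H_mat n k))"
    by (auto simp: rows_def distinct_map inj_on_def H_mat_def)
  then show ?thesis
    by (auto simp: distinct_row_mats_def H_mat_def elements_mat_def)
qed

end

theory Submission
  imports Defs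
begin

text \<open>
  Write s(i) for the number of ones of i in binary, view rows as subsets of the columns, and let
  d = n - q be the number of deleted columns. Both sides are compared with the sum of
  (n - s(i) choose d) over i < k.

  For a family A, split by the last column into A0 and A1 (with the column removed), and put
  U = A0 \<union> A1, I = A0 \<inter> A1, so that |A| = |U| + |I|. If the last column is deleted, the trace of A is
  that of U; otherwise it has at least as many elements as the traces of U and I together.
  Induction on n reduces the lower bound to the inequality
  \<open>\<Sum>i<b. w (s (a + i)) \<le> \<Sum>i<b. w (s i + 1)\<close> for b \<le> a and antitone w, which follows by induction on
  a + b, separating even and odd numbers. For the matrix H, clearing binary digits of a row
  yields an earlier row, so each trace is represented by rows supported inside Q, and counting
  the sets Q that contain the support of a row gives the upper bound.
\<close>

section \<open>Binary digits and digit sums\<close>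

definition bits :: "nat \<Rightarrow> nat set" where
  "bits i = {b. bit i b}"

definition popcount :: "nat \<Rightarrow> nat" where
  "popcount i = card (bits i)"

lemma bits_less: "i < 2 ^ n \<Longrightarrow> bits i \<subseteq> {0..<n}"
  unfolding bits_def by (metis (mono_tags, lifting) atLeastLessThan_iff bit_take_bit_iff mem_Collect_eq subsetI take_bit_nat_eq_self zero_le)

lemma finite_bits [simp]: "finite (bits i)"
  \<comment> \<open>Since \<open>i < 2 ^ i\<close>, the number \<open>i\<close> bounds its own digit
    positions.\<close>
  by (rule finite_subset[OF bits_less[of i i]]) auto

lemma bits_0 [simp]: "bits 0 = {}"
  by (simp add: bits_def)

lemma bits_double: "bits (2 * i) = Suc ` bits i"
proof (rule Set.set_eqI)
  show "b \<in> bits (2 * i) \<longleftrightarrow> b \<in> Suc ` bits i" for b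
    by (cases b) (auto simp: bits_def bit_0 bit_Suc)
qed

lemma bits_double_Suc: "bits (Suc (2 * i)) = insert 0 (Suc ` bits i)"
proof (rule Set.set_eqI)
  show "b \<in> bits (Suc (2 * i)) \<longleftrightarrow> b \<in> insert 0 (Suc ` bits i)" for b
    by (cases b) (auto simp: bits_def bit_0 bit_Suc)
qed

lemma popcount_double [simp]: "popcount (2 * i) = popcount i"
  by (simp add: popcount_def bits_double card_image)

lemma popcount_double_Suc [simp]: "popcount (Suc (2 * i)) = Suc (popcount i)"
  by (simp add: popcount_def bits_double_Suc card_image card_insert_if)

text \<open>Clearing a digit never increases a number, and finitely many clearings lead from
  \<open>bits i\<close> to \<open>S\<close>. Hence the digit sets of the numbers below a bound form
  a family closed under subsets.\<close>

lemma exists_smaller_bits: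
  assumes "S \<subseteq> bits i"
  shows "\<exists>i'\<le>i. bits i' = S"
proof -
  have "finite T \<Longrightarrow> \<exists>i'\<le>i. bits i' = bits i - T" for T
  proof (induction T rule: finite_induct)
    case (insert x T)
    then obtain i' where i': "i' \<le> i" "bits i' = bits i - T" by blast
    have "bits (unset_bit x i') = bits i' - {x}"
      by (auto simp: bits_def bit_unset_bit_iff)
    moreover have "unset_bit x i' \<le> i'"
      by (simp flip: zle_int add: of_nat_unset_bit_eq unset_bit_less_eq)
    ultimately show ?case
      using i' by (intro exI[of _ "unset_bit x i'"]) auto
  qed auto
  from this[of "bits i - S"] show ?thesis
    using assms by (simp add: double_diff)
qed

lemma sum_lessThan_double:
  fixes f :: "nat \<Rightarrow> nat"
  shows "(\<Sum>i<2 * b. f i) = (\<Sum>i<b. f (2 * i)) + (\<Sum>i<b. f (Suc (2 * i)))"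
  by (induction b) auto

text \<open>Allowing every antitone weight keeps the induction closed: odd numbers carry one extra
  digit, which turns \<open>w\<close> into \<open>\<lambda>s. w (Suc s)\<close>. For threshold
  weights the claim is a domination: for each t, at most as many of the shifted numbers have digit
  sum at most t as there are \<open>i < b\<close> with \<open>Suc (popcount i)\<close> at most
  t.\<close>

lemma sum_popcount_shift:
  fixes w :: "nat \<Rightarrow> nat"
  assumes "antimono w" "b \<le> a"
  shows "(\<Sum>i<b. w (popcount (a + i))) \<le> (\<Sum>i<b. w (Suc (popcount i)))"
  using assms
proof (induction "a + b" arbitrary: a b w rule: less_induct)
  case less
  have w': "antimono (\<lambda>s. w (Suc s))"
    using less.prems(1) by (simp add: antimono_def)
  note IH = less.hyps[OF _ less.prems(1)] and IH' = less.hyps[OF _ w']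
  consider "b = 0"
    | a' b' where "b > 0" "a = 2 * a'" "b = 2 * b'"
    | a' b' where "a = 2 * a'" "b = Suc (2 * b')"
    | a' b' where "b > 0" "a = Suc (2 * a')" "b = 2 * b'"
    | a' b' where "a = Suc (2 * a')" "b = Suc (2 * b')"
    by (metis evenE oddE Suc_eq_plus1 not_gr_zero)
  \<comment> \<open>Halving the even and the odd numbers of each interval separately gives shorter
    instances. For odd \<open>a\<close>, the even numbers \<open>a + 2 * i + 1\<close> halve to an
    interval that starts at \<open>Suc a'\<close>.\<close>
  then show ?case
  proof cases
    case 1
    then show ?thesis by simp
  next
    case 2
    have eqs: "popcount (a + 2 * i) = popcount (a' + i)"
      "popcount (Suc (a + 2 * i)) = Suc (popcount (a' + i))" for i
      using popcount_double[of "a' + i"] popcount_double_Suc[of "a' + i"] 2 by simp_all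
    have evens: "(\<Sum>i<b'. w (popcount (a' + i))) \<le> (\<Sum>i<b'. w (Suc (popcount i)))"
      using 2 less.prems by (intro IH) auto
    have odds: "(\<Sum>i<b'. w (Suc (popcount (a' + i)))) \<le> (\<Sum>i<b'. w (Suc (Suc (popcount i))))"
      using 2 less.prems by (intro IH') auto
    show ?thesis
      using evens odds by (simp add: 2(3) sum_lessThan_double eqs)
  next
    case 3
    have eqs: "popcount (a + 2 * i) = popcount (a' + i)"
      "popcount (Suc (a + 2 * i)) = Suc (popcount (a' + i))" for i
      using popcount_double[of "a' + i"] popcount_double_Suc[of "a' + i"] 3 by simp_all
    \<comment> \<open>With \<open>a\<close> even and \<open>b\<close> odd, \<open>b \<le> a\<close>
      is strict, so \<open>Suc b' \<le> a'\<close> and the extra even term still fits the induction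
      hypothesis.\<close>
    have evens: "(\<Sum>i<Suc b'. w (popcount (a' + i))) \<le> (\<Sum>i<Suc b'. w (Suc (popcount i)))"
      using 3 less.prems by (intro IH) auto
    have odds: "(\<Sum>i<b'. w (Suc (popcount (a' + i)))) \<le> (\<Sum>i<b'. w (Suc (Suc (popcount i))))"
      using 3 less.prems by (intro IH') auto
    show ?thesis
      using evens odds by (simp add: 3(2) sum_lessThan_double eqs)
  next
    case 4
    have eqs: "popcount (a + 2 * i) = Suc (popcount (a' + i))"
      "popcount (Suc (a + 2 * i)) = popcount (Suc (a' + i))" for i
      using popcount_double_Suc[of "a' + i"] popcount_double[of "Suc a' + i"] 4 by simp_all
    have evens: "(\<Sum>i<b'. w (popcount (Suc a' + i))) \<le> (\<Sum>i<b'. w (Suc (popcount i)))"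
      using 4 less.prems by (intro IH) auto
    have odds: "(\<Sum>i<b'. w (Suc (popcount (a' + i)))) \<le> (\<Sum>i<b'. w (Suc (Suc (popcount i))))"
      using 4 less.prems by (intro IH') auto
    show ?thesis
      using evens odds by (simp add: 4(3) sum_lessThan_double eqs)
  next
    case 5
    \<comment> \<open>Now a + i is odd for b' + 1 indices, but i itself only for b'. The surplus term is
      absorbed by antitonicity, unless b' = a', where it is computed exactly.\<close>
    have eqs: "popcount (a + 2 * i) = Suc (popcount (a' + i))"
      "popcount (Suc (a + 2 * i)) = popcount (Suc (a' + i))" for i
      using popcount_double_Suc[of "a' + i"] popcount_double[of "Suc a' + i"] 5 by simp_all
    have evens: "(\<Sum>i<b'. w (popcount (Suc a' + i))) \<le> (\<Sum>i<b'. w (Suc (popcount i)))"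
      using IH[of "Suc a'" b'] 5 less.prems by simp
    have odds: "(\<Sum>i<Suc b'. w (Suc (popcount (a' + i))))
        \<le> (\<Sum>i<b'. w (Suc (Suc (popcount i)))) + w (Suc (popcount b'))"
    proof (cases "b' = a'")
      case True
      have "w (Suc (popcount (a' + a'))) = w (Suc (popcount a'))"
        by (simp flip: mult_2)
      then show ?thesis
        using IH'[of a' b'] 5 True by simp
    next
      case False
      have "w (Suc (Suc (popcount b'))) \<le> w (Suc (popcount b'))"
        using less.prems(1) by (simp add: antimonoD)
      then show ?thesis
        using IH'[of a' "Suc b'"] 5 False less.prems by simp
    qed
    show ?thesis
      using evens odds by (simp add: 5(2) sum_lessThan_double eqs)
  qed
qed

section \<open>Families of sets: the lower bound for traces\<close>

lemma finite_col_sets [simp]: "finite (col_sets n q)"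
  by (rule finite_subset[of _ "Pow {0..<n}"]) (auto simp: col_sets_def)

lemma col_sets_0 [simp]: "col_sets n 0 = {{}}"
  \<comment> \<open>Infinite sets also have \<open>card\<close> 0, so finiteness must be supplied to
    single out the empty set.\<close>
  using finite_subset[of _ "{0..<n}"] by (auto simp: col_sets_def)

lemma inj_on_insert:
  assumes "\<And>S. S \<in> C \<Longrightarrow> x \<notin> S"
  shows "inj_on (insert x) C"
  by (rule inj_onI) (simp add: assms insert_ident)

lemma sum_col_sets_Suc:
  "(\<Sum>D\<in>col_sets (Suc n) (Suc d). f D) =
     (\<Sum>D\<in>col_sets n (Suc d). f D) + (\<Sum>D\<in>col_sets n d. f (insert n D) :: nat)"
proof -
  have fin: "finite D" if "D \<subseteq> {0..<n}" for D
    using that finite_subset by blast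
  have "col_sets (Suc n) (Suc d) = col_sets n (Suc d) \<union> insert n ` col_sets n d"
  proof (intro equalityI subsetI)
    fix D assume D: "D \<in> col_sets (Suc n) (Suc d)"
    show "D \<in> col_sets n (Suc d) \<union> insert n ` col_sets n d"
    proof (cases "n \<in> D")
      case True
      then have "D = insert n (D - {n})" by auto
      moreover have "D - {n} \<in> col_sets n d"
        using D True by (fastforce simp: col_sets_def)
      ultimately show ?thesis by blast
    next
      case False
      then show ?thesis
        using D by (fastforce simp: col_sets_def atLeast0_lessThan_Suc)
    qed
  next
    fix D assume "D \<in> col_sets n (Suc d) \<union> insert n ` col_sets n d"
    then show "D \<in> col_sets (Suc n) (Suc d)"
      using fin by (force simp: col_sets_def card_insert_if)
  qed
  moreover have "col_sets n (Suc d) \<inter> insert n ` col_sets n d = {}"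
    by (auto simp: col_sets_def)
  moreover have "inj_on (insert n) (col_sets n d)"
    by (rule inj_on_insert) (auto simp: col_sets_def)
  ultimately show ?thesis
    by (simp add: sum.union_disjoint sum.reindex)
qed

text \<open>Pascal's rule handles the first \<open>a\<close> terms. On the last \<open>b\<close>
  terms the shift inequality raises each digit sum by one, which cancels the \<open>Suc\<close> in
  \<open>Suc n\<close>. The sizes of the union and the intersection of two families will play the
  roles of \<open>a\<close> and \<open>b\<close>.\<close>

lemma sum_choose_split:
  assumes "b \<le> a"
  shows "(\<Sum>i<a + b. (Suc n - popcount i) choose Suc d) \<le>
    (\<Sum>i<a. (n - popcount i) choose d) + (\<Sum>i<a. (n - popcount i) choose Suc d)
    + (\<Sum>i<b. (n - popcount i) choose Suc d)"
proof -
  \<comment> \<open>This is an equality for \<open>s \<le> n\<close>; beyond that, truncated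
    subtraction makes the left side 0.\<close>
  have pascal: "(Suc n - s) choose Suc d \<le> ((n - s) choose d) + ((n - s) choose Suc d)" for s
    by (cases "s \<le> n") (auto simp: Suc_diff_le)
  have "(\<Sum>i<a + b. (Suc n - popcount i) choose Suc d) =
      (\<Sum>i<a. (Suc n - popcount i) choose Suc d)
      + (\<Sum>i<b. (Suc n - popcount (a + i)) choose Suc d)"
    by (induction b) auto
  also have "\<dots> \<le> (\<Sum>i<a. ((n - popcount i) choose d) + ((n - popcount i) choose Suc d))
      + (\<Sum>i<b. (Suc n - Suc (popcount i)) choose Suc d)"
    using assms
    by (intro add_mono sum_mono pascal sum_popcount_shift[of "\<lambda>s. (Suc n - s) choose Suc d"])
      (auto simp: antimono_def intro!: binomial_right_mono)
  finally show ?thesis by (simp add: sum.distrib)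
qed

text \<open>Here \<open>D\<close> is the set of deleted columns, so \<open>S - D\<close> is the
  trace of \<open>S\<close>. Both \<open>A\<close> and \<open>d\<close> vary in the induction:
  \<open>A\<close> gives way to the union and the intersection of its two halves, and
  \<open>d\<close> drops by one when the last column is deleted.\<close>

lemma trace_sum_lower_bound:
  assumes "A \<subseteq> Pow {0..<n}"
  shows "(\<Sum>i<card A. (n - popcount i) choose d)
    \<le> (\<Sum>D\<in>col_sets n d. card ((\<lambda>S. S - D) ` A))"
  using assms
proof (induction n arbitrary: A d)
  case 0
  then show ?case
    by (cases d) auto
next
  case (Suc n)
  have fin: "finite A" using Suc.prems by (rule finite_subset) simp
  show ?case
  proof (cases d)
    case 0
    then show ?thesis by simp
  next
    case d: (Suc d')
    define A0 where "A0 = {S \<in> A. n \<notin> S}"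
    define A1 where "A1 = (\<lambda>S. S - {n}) ` {S \<in> A. n \<in> S}"
    have sub: "A0 \<subseteq> Pow {0..<n}" "A1 \<subseteq> Pow {0..<n}"
      using Suc.prems by (force simp: A0_def A1_def atLeast0_lessThan_Suc)+
    have fin01: "finite A0" "finite A1"
      using fin by (auto simp: A0_def A1_def)
    have A_eq: "A = A0 \<union> insert n ` A1"
    proof -
      have "insert n ` A1 = (\<lambda>S. S) ` {S \<in> A. n \<in> S}"
        unfolding A1_def image_image by (intro image_cong refl) auto
      then show ?thesis by (auto simp: A0_def)
    qed
    have n_notin: "n \<notin> S" if "S \<in> A0 \<union> A1" for S
      using that by (auto simp: A0_def A1_def)
    have card_split: "card (B \<union> insert n ` C) = card B + card C"
      if "finite B" "finite C" "\<And>S. S \<in> B \<union> C \<Longrightarrow> n \<notin> S" for B C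
    proof -
      have "inj_on (insert n) C"
        using that(3) by (intro inj_on_insert) auto
      moreover have "B \<inter> insert n ` C = {}"
        using that(3) by auto
      ultimately show ?thesis
        using that by (simp add: card_Un_disjoint card_image)
    qed
    have card_A: "card A = card (A0 \<union> A1) + card (A0 \<inter> A1)"
      using card_split[OF fin01 n_notin] card_Un_Int[OF fin01] by (simp add: A_eq)
    have not_deleted: "card ((\<lambda>S. S - D) ` (A0 \<union> A1)) + card ((\<lambda>S. S - D) ` (A0 \<inter> A1))
        \<le> card ((\<lambda>S. S - D) ` A)" if D: "D \<in> col_sets n d" for D
    proof -
      let ?B = "(\<lambda>S. S - D) ` A0" and ?C = "(\<lambda>S. S - D) ` A1"
      have "n \<notin> D" using D by (auto simp: col_sets_def)
      then have "(\<lambda>S. S - D) ` A = ?B \<union> insert n ` ?C"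
        by (simp add: A_eq image_Un image_image insert_Diff_if)
      then have "card ((\<lambda>S. S - D) ` A) = card ?B + card ?C"
        using card_split[of ?B ?C] fin01 n_notin by auto
      also have "\<dots> = card (?B \<union> ?C) + card (?B \<inter> ?C)"
        using fin01 by (intro card_Un_Int) auto
      \<comment> \<open>Taking traces commutes with unions, but the trace of an intersection is only
        contained in the intersection of the traces.\<close>
      also have "\<dots> \<ge> card ((\<lambda>S. S - D) ` (A0 \<union> A1)) + card ((\<lambda>S. S - D) ` (A0 \<inter> A1))"
        unfolding image_Un using fin01 by (intro add_left_mono card_mono) auto
      finally show ?thesis .
    qed
    have deleted: "(\<lambda>S. S - insert n D) ` A = (\<lambda>S. S - D) ` (A0 \<union> A1)" for D
    proof -
      have "S - insert n D = S - D" if "S \<in> A0 \<union> A1" for S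
        using n_notin[OF that] by auto
      then have "(\<lambda>S. S - insert n D) ` (A0 \<union> A1) = (\<lambda>S. S - D) ` (A0 \<union> A1)"
        by (rule image_cong[OF refl])
      then show ?thesis
        by (simp add: A_eq image_Un image_image)
    qed
    have "(\<Sum>i<card A. (Suc n - popcount i) choose d)
        \<le> (\<Sum>i<card (A0 \<union> A1). (n - popcount i) choose d')
          + (\<Sum>i<card (A0 \<union> A1). (n - popcount i) choose d)
          + (\<Sum>i<card (A0 \<inter> A1). (n - popcount i) choose d)"
      unfolding card_A d using fin01 by (intro sum_choose_split card_mono) auto
    also have "\<dots> \<le> (\<Sum>D\<in>col_sets n d'. card ((\<lambda>S. S - D) ` (A0 \<union> A1)))
          + (\<Sum>D\<in>col_sets n d. card ((\<lambda>S. S - D) ` (A0 \<union> A1)))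
          + (\<Sum>D\<in>col_sets n d. card ((\<lambda>S. S - D) ` (A0 \<inter> A1)))"
      using sub by (intro add_mono Suc.IH) auto
    also have "\<dots> \<le> (\<Sum>D\<in>col_sets n d'. card ((\<lambda>S. S - insert n D) ` A))
          + (\<Sum>D\<in>col_sets n d. card ((\<lambda>S. S - D) ` A))"
      unfolding deleted using sum_mono[OF not_deleted]
      by (simp add: sum.distrib)
    also have "\<dots> = (\<Sum>D\<in>col_sets (Suc n) d. card ((\<lambda>S. S - D) ` A))"
      by (simp add: d sum_col_sets_Suc)
    finally show ?thesis .
  qed
qed

section \<open>Rows of 0/1 matrices as sets of columns\<close>

lemma card_image_eq_if:
  assumes "\<And>x y. x \<in> I \<Longrightarrow> y \<in> I \<Longrightarrow> f x = f y \<longleftrightarrow> g x = g y"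
  shows "card (f ` I) = card (g ` I)"
proof (rule bij_betw_same_card)
  \<comment> \<open>The chosen preimage may differ from \<open>x\<close>, but it lies in the same
    fibre of \<open>f\<close>, hence in the same fibre of \<open>g\<close>.\<close>
  have eq: "g (inv_into I f (f x)) = g x" if "x \<in> I" for x
    using assms[of "inv_into I f (f x)" x] that
    by (simp add: f_inv_into_f inv_into_into)
  show "bij_betw (g \<circ> inv_into I f) (f ` I) (g ` I)"
    by (rule bij_betw_imageI) (auto simp: inj_on_def eq assms image_image)
qed

text \<open>\<open>submatrix\<close> renumbers the kept columns through \<open>pick Q\<close>, which
  maps the indices below \<open>card Q\<close> onto \<open>Q\<close>; row numbers are unchanged
  because all rows are kept.\<close>

lemma row_submatrix_eq_iff:
  assumes "M \<in> carrier_mat k n" "Q \<subseteq> {0..<n}" "i < k" "i' < k"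
  shows "row (submatrix M UNIV Q) i = row (submatrix M UNIV Q) i' \<longleftrightarrow>
    (\<forall>j\<in>Q. M $$ (i, j) = M $$ (i', j))"
proof -
  have dims: "dim_row (submatrix M UNIV Q) = k" "dim_col (submatrix M UNIV Q) = card Q"
  proof -
    have "{j. j < n \<and> j \<in> Q} = Q" using assms(2) by auto
    then show "dim_row (submatrix M UNIV Q) = k" "dim_col (submatrix M UNIV Q) = card Q"
      using assms(1) by (auto simp: dim_submatrix)
  qed
  have fin: "finite Q" using assms(2) finite_subset by blast
  have entry: "submatrix M UNIV Q $$ (r, j) = M $$ (r, pick Q j)" if "r < k" "j < card Q" for r j
  proof -
    have "{j. j < n \<and> j \<in> Q} = Q" using assms(2) by auto
    then show ?thesis
      using submatrix_index[of r M UNIV j Q] that assms(1) by (simp add: pick_UNIV)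
  qed
  \<comment> \<open>Surjectivity follows by counting: \<open>pick Q\<close> is strictly increasing,
    hence injective, and \<open>Q\<close> is finite.\<close>
  have pick: "pick Q ` {..<card Q} = Q"
  proof (rule card_seteq)
    show "pick Q ` {..<card Q} \<subseteq> Q"
      using fin pick_in_set_le by auto
    have "inj_on (pick Q) {..<card Q}"
      using fin by (metis (no_types, lifting) inj_onI lessThan_iff linorder_neqE_nat pick_mono_le order_less_irrefl)
    then show "card Q \<le> card (pick Q ` {..<card Q})"
      by (simp add: card_image)
  qed (rule fin)
  have "row (submatrix M UNIV Q) i = row (submatrix M UNIV Q) i' \<longleftrightarrow>
      (\<forall>j<card Q. M $$ (i, pick Q j) = M $$ (i', pick Q j))"
    using assms(3,4) dims entry by (auto simp: vec_eq_iff)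
  also have "\<dots> \<longleftrightarrow> (\<forall>j\<in>pick Q ` {..<card Q}. M $$ (i, j) = M $$ (i', j))"
    by auto
  finally show ?thesis by (simp only: pick)
qed

definition row_support :: "nat mat \<Rightarrow> nat \<Rightarrow> nat set" where
  "row_support M i = {j. j < dim_col M \<and> M $$ (i, j) = 1}"

text \<open>With entries 0 and 1, two entries agree exactly when both or neither of their positions
  lie in the supports. Distinct rows of the submatrix thus correspond to distinct traces of the
  supports on \<open>Q\<close>.\<close>

lemma dif_submatrix:
  fixes M :: "nat mat"
  assumes M: "M \<in> carrier_mat k n" "elements_mat M \<subseteq> {0, 1}" and Q: "Q \<subseteq> {0..<n}"
  shows "dif (submatrix M UNIV Q) = card ((\<lambda>i. row_support M i \<inter> Q) ` {..<k})"
proof -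
  have dim: "dim_row (submatrix M UNIV Q) = k"
    using M by (simp add: dim_submatrix)
  have "M $$ (i, j) \<in> {0, 1}" if "i < k" "j < n" for i j
    using M that unfolding elements_mat_def by fastforce
  then have "M $$ (i, j) = M $$ (i', j) \<longleftrightarrow> (j \<in> row_support M i \<longleftrightarrow> j \<in> row_support M i')"
    if "i < k" "i' < k" "j < n" for i i' j
    using that M by (auto simp: row_support_def) (metis empty_iff insert_iff)+
  then have "row (submatrix M UNIV Q) i = row (submatrix M UNIV Q) i' \<longleftrightarrow>
      (\<forall>j\<in>Q. j \<in> row_support M i \<longleftrightarrow> j \<in> row_support M i')"
    if "i < k" "i' < k" for i i'
    unfolding row_submatrix_eq_iff[OF M(1) Q that]
    using that Q by (intro ball_cong refl) auto
  then have "row (submatrix M UNIV Q) i = row (submatrix M UNIV Q) i' \<longleftrightarrow>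
      row_support M i \<inter> Q = row_support M i' \<inter> Q" if "i < k" "i' < k" for i i'
    using that by blast
  then have "card (row (submatrix M UNIV Q) ` {..<k}) =
      card ((\<lambda>i. row_support M i \<inter> Q) ` {..<k})"
    by (intro card_image_eq_if) simp
  moreover have "set (rows (submatrix M UNIV Q)) = row (submatrix M UNIV Q) ` {..<k}"
    by (auto simp: rows_def dim)
  ultimately show ?thesis by (simp add: dif_def)
qed

section \<open>Kept and deleted columns; the lower bound for matrices\<close>

lemma bij_betw_col_sets_complement:
  assumes "q \<le> n"
  shows "bij_betw (\<lambda>D. {0..<n} - D) (col_sets n (n - q)) (col_sets n q)"
proof (rule bij_betwI[where g = "\<lambda>D. {0..<n} - D"])
  have "{0..<n} - D \<in> col_sets n (n - r)" if "D \<in> col_sets n r" for D r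
    using that finite_subset[of D "{0..<n}"] by (simp add: col_sets_def card_Diff_subset)
  \<comment> \<open>The return direction needs \<open>n - (n - q) = q\<close>, which holds because
    \<open>q \<le> n\<close>.\<close>
  from this[of _ "n - q"] this[of _ q] assms
  show "(\<lambda>D. {0..<n} - D) \<in> col_sets n (n - q) \<rightarrow> col_sets n q"
    "(\<lambda>D. {0..<n} - D) \<in> col_sets n q \<rightarrow> col_sets n (n - q)"
    by auto
qed (auto simp: col_sets_def)

text \<open>Distinct 0/1 rows have distinct supports, so the supports form a family of exactly
  \<open>k\<close> sets. The bound for families applies with \<open>n - q\<close> deleted
  columns.\<close>

lemma msum_lower_bound:
  assumes M: "M \<in> distinct_row_mats n k" and "q \<le> n"
  shows "(\<Sum>i<k. (n - popcount i) choose (n - q)) \<le> msum q M"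
proof -
  let ?A = "row_support M ` {..<k}"
  have carrier: "M \<in> carrier_mat k n" "elements_mat M \<subseteq> {0, 1}" and dist: "distinct (rows M)"
    using M by (auto simp: distinct_row_mats_def)
  have dif: "dif (submatrix M UNIV ({0..<n} - D)) = card ((\<lambda>S. S - D) ` ?A)" for D
  proof -
    have "row_support M i \<inter> ({0..<n} - D) = row_support M i - D" for i
      using carrier by (auto simp: row_support_def)
    then show ?thesis
      by (simp add: dif_submatrix[OF carrier] image_image)
  qed
  have "row_support M i \<noteq> row_support M i'" if "i < k" "i' < k" "i \<noteq> i'" for i i'
  proof
    assume eq: "row_support M i = row_support M i'"
    have "M $$ (i, j) = M $$ (i', j)" if j: "j < n" for j
    proof -
      have "M $$ (i, j) \<in> {0, 1}" "M $$ (i', j) \<in> {0, 1}"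
        using carrier j \<open>i < k\<close> \<open>i' < k\<close> unfolding elements_mat_def by fastforce+
      moreover have "M $$ (i, j) = 1 \<longleftrightarrow> M $$ (i', j) = 1"
        using eq j carrier by (auto simp: row_support_def Set.set_eq_iff)
      ultimately show ?thesis by auto
    qed
    then have "row M i = row M i'"
      using carrier that by (auto simp: vec_eq_iff)
    then show False
      using dist that carrier by (auto simp: rows_def distinct_map inj_on_def)
  qed
  then have card_A: "card ?A = k"
    by (subst card_image) (auto simp: inj_on_def)
  have "(\<Sum>i<k. (n - popcount i) choose (n - q))
      \<le> (\<Sum>D\<in>col_sets n (n - q). card ((\<lambda>S. S - D) ` ?A))"
    using trace_sum_lower_bound[of ?A n "n - q"] carrier
    unfolding card_A by (force simp: row_support_def)
  also have "\<dots> = (\<Sum>Q\<in>col_sets n q. dif (submatrix M UNIV Q))"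
    using sum.reindex_bij_betw[OF bij_betw_col_sets_complement[OF \<open>q \<le> n\<close>],
        of "\<lambda>Q. dif (submatrix M UNIV Q)"]
    by (simp add: dif)
  also have "\<dots> = msum q M"
    using carrier by (simp add: msum_def)
  finally show ?thesis .
qed

section \<open>The upper bound for \<open>H_mat\<close> and the conclusion\<close>

lemma card_col_sets_superset:
  assumes "B \<subseteq> {0..<n}" "q \<le> n"
  shows "card {Q \<in> col_sets n q. B \<subseteq> Q} = (n - card B) choose (n - q)"
proof -
  have fin: "finite B" using assms finite_subset by blast
  \<comment> \<open>A set \<open>Q\<close> contains \<open>B\<close> exactly when its complement
    avoids \<open>B\<close>, so \<open>n - q\<close> columns are to be chosen outside
    \<open>B\<close>.\<close>
  have "bij_betw (\<lambda>D. {0..<n} - D) {D. D \<subseteq> {0..<n} - B \<and> card D = n - q} {Q \<in> col_sets n q. B \<subseteq> Q}"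
  proof (rule bij_betw_subset[OF bij_betw_col_sets_complement[OF assms(2)]])
    show "(\<lambda>D. {0..<n} - D) ` {D. D \<subseteq> {0..<n} - B \<and> card D = n - q} = {Q \<in> col_sets n q. B \<subseteq> Q}"
    proof (intro equalityI subsetI)
      fix Q assume "Q \<in> {Q \<in> col_sets n q. B \<subseteq> Q}"
      then have "Q = {0..<n} - ({0..<n} - Q)" "{0..<n} - Q \<subseteq> {0..<n} - B"
        "card ({0..<n} - Q) = n - q"
        using finite_subset[of Q "{0..<n}"] by (auto simp: col_sets_def card_Diff_subset)
      then show "Q \<in> (\<lambda>D. {0..<n} - D) ` {D. D \<subseteq> {0..<n} - B \<and> card D = n - q}"
        by blast
    next
      fix Q assume "Q \<in> (\<lambda>D. {0..<n} - D) ` {D. D \<subseteq> {0..<n} - B \<and> card D = n - q}"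
      then obtain D where D: "D \<subseteq> {0..<n} - B" "card D = n - q" "Q = {0..<n} - D" by blast
      moreover have "D \<in> col_sets n (n - q)" using D by (auto simp: col_sets_def)
      ultimately show "Q \<in> {Q \<in> col_sets n q. B \<subseteq> Q}"
        using bij_betw_col_sets_complement[OF assms(2)] assms(1)
        by (auto dest: bij_betwE)
    qed
  qed (auto simp: col_sets_def)
  then have "card {Q \<in> col_sets n q. B \<subseteq> Q} = card {D. D \<subseteq> {0..<n} - B \<and> card D = n - q}"
    by (simp add: bij_betw_same_card)
  also have "\<dots> = (n - card B) choose (n - q)"
    using assms fin by (simp add: n_subsets card_Diff_subset)
  finally show ?thesis .
qed

lemma hsum_upper_bound:
  assumes "k \<le> 2 ^ n" "q \<le> n"
  shows "hsum q n k \<le> (\<Sum>i<k. (n - popcount i) choose (n - q))"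
proof -
  \<comment> \<open>The most significant digit stands in column 0, so digit \<open>b\<close> is in
    column \<open>?r b\<close>. This reversal is its own inverse on \<open>{0..<n}\<close>.\<close>
  let ?r = "\<lambda>b. n - 1 - b"
  have carrier: "H_mat n k \<in> carrier_mat k n" "elements_mat (H_mat n k) \<subseteq> {0, 1}"
    using H_mat_in_distinct_row_mats[OF assms(1)] by (auto simp: distinct_row_mats_def)
  have bits_sub: "bits i \<subseteq> {0..<n}" if "i < k" for i
    using bits_less[of i n] that assms(1) by simp
  have support: "row_support (H_mat n k) i = ?r ` bits i" if "i < k" for i
  proof (intro equalityI subsetI)
    fix j assume "j \<in> row_support (H_mat n k) i"
    then have "?r j \<in> bits i" "j = ?r (?r j)"
      using that by (auto simp: row_support_def H_mat_def bits_def of_bool_def split: if_splits)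
    then show "j \<in> ?r ` bits i" by blast
  next
    fix j assume "j \<in> ?r ` bits i"
    then obtain b where "b \<in> bits i" "j = ?r b" "b < n" using bits_sub[OF \<open>i < k\<close>] by auto
    then show "j \<in> row_support (H_mat n k) i"
      using that by (auto simp: row_support_def H_mat_def bits_def)
  qed
  have "inj_on ?r {0..<n}" by (rule inj_onI) auto
  then have card_support: "card (?r ` bits i) = popcount i" if "i < k" for i
    unfolding popcount_def
    using inj_on_subset[OF _ bits_sub[OF that]] by (intro card_image)
  have "dif (submatrix (H_mat n k) UNIV Q) \<le> card {i. i < k \<and> ?r ` bits i \<subseteq> Q}"
    if Q: "Q \<in> col_sets n q" for Q
  proof -
    have "(\<lambda>i. row_support (H_mat n k) i \<inter> Q) ` {..<k}
        \<subseteq> (\<lambda>i. ?r ` bits i) ` {i. i < k \<and> ?r ` bits i \<subseteq> Q}"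
    proof (rule image_subsetI)
      fix i assume i: "i \<in> {..<k}"
      \<comment> \<open>Keeping only the digits whose columns lie in \<open>Q\<close> gives a number
        \<open>i' \<le> i < k\<close>, so it is again a row index, and its support is the trace of
        row \<open>i\<close>.\<close>
      obtain i' where i': "i' \<le> i" "bits i' = {b \<in> bits i. ?r b \<in> Q}"
        using exists_smaller_bits[of "{b \<in> bits i. ?r b \<in> Q}" i] by blast
      then have "row_support (H_mat n k) i \<inter> Q = ?r ` bits i'"
        using i support[of i] by auto
      moreover have "?r ` bits i' \<subseteq> Q" "i' < k" using i i' by auto
      ultimately show "row_support (H_mat n k) i \<inter> Q
          \<in> (\<lambda>i. ?r ` bits i) ` {i. i < k \<and> ?r ` bits i \<subseteq> Q}"
        by blast
    qed
    then have "card ((\<lambda>i. row_support (H_mat n k) i \<inter> Q) ` {..<k})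
        \<le> card {i. i < k \<and> ?r ` bits i \<subseteq> Q}"
      by (intro surj_card_le) auto
    then show ?thesis
      using dif_submatrix[OF carrier, of Q] Q by (simp add: col_sets_def)
  qed
  then have "hsum q n k \<le> (\<Sum>Q\<in>col_sets n q. card {i. i < k \<and> ?r ` bits i \<subseteq> Q})"
    using carrier by (auto simp: hsum_def msum_def intro!: sum_mono)
  also have "\<dots> = (\<Sum>Q\<in>col_sets n q. card {i \<in> {..<k}. ?r ` bits i \<subseteq> Q})"
    by simp
  \<comment> \<open>Double counting of the pairs of a row and a column set containing its
    support.\<close>
  also have "\<dots> = (\<Sum>i<k. card {Q \<in> col_sets n q. ?r ` bits i \<subseteq> Q})"
    by (rule sum_multicount_gen) auto
  also have "\<dots> = (\<Sum>i<k. (n - popcount i) choose (n - q))"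
  proof (rule sum.cong[OF refl])
    fix i assume "i \<in> {..<k}"
    then have i: "i < k" by simp
    have "?r ` bits i \<subseteq> {0..<n}" using bits_sub[OF i] by auto
    from card_col_sets_superset[OF this assms(2)]
    show "card {Q \<in> col_sets n q. ?r ` bits i \<subseteq> Q} = (n - popcount i) choose (n - q)"
      by (simp only: card_support[OF i])
  qed
  finally show ?thesis .
qed

theorem theorem2p1:
  fixes q n k :: nat
  assumes "q > 0" and "n > 0" and "k > 0"
    and "q \<le> n" and "k \<le> 2 ^ n"
  shows "msum_min q n k = hsum q n k"
  unfolding msum_min_def
proof (rule Min_eqI)
  show "finite (msum q ` distinct_row_mats n k)"
    by (simp add: finite_distinct_row_mats)
  show "hsum q n k \<in> msum q ` distinct_row_mats n k"
    using H_mat_in_distinct_row_mats[OF assms(5)] by (simp add: hsum_def)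
  \<comment> \<open>The same binomial sum bounds \<open>hsum q n k\<close> from above and
    \<open>msum q M\<close> from below for every admissible \<open>M\<close>.\<close>
  show "hsum q n k \<le> m" if "m \<in> msum q ` distinct_row_mats n k" for m
    using that hsum_upper_bound[OF assms(5,4)] msum_lower_bound[OF _ assms(4), of _ k]
    by fastforce
qed

end
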